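(* Let $\mathcal{A}'$ be the randomized online algorithm described in the context. Then for every instance, \[ \mathbb{E}\Big[\sum_{j\in J} w_j C_j^{\mathcal{A}'}\Big] \le \Big(\frac{1}{\ln 2}\alpha\beta+\gamma\Big)\sum_{j\in J} w_j C_j^{\mathcal{OPT}} + \alpha W, \] where $C_j^{\mathcal{OPT}}$ is the completion time of $j$ in an optimal offline schedule respecting release times and $W=\sum_j w_j$.
   Context: Fix a scheduling environment with a set $J$ of jobs; each job $j$ has weight $w_j\ge0$ and release time $r_j\ge0$, and no part of $j$ may be processed before $r_j$. Schedules of disjoint job sets on disjoint time intervals can be combined. Standing assumption: all processing times are at least $1$. Online, job $j$ becomes known at $r_j$; the objective is $\sum_j w_jC_j$. MUWP: given jobs with weights and a deadline $D$, find a subset $S$ that can be completed by time $D$ minimizing the total weight of jobs not in $S$. An $(\alpha,\beta)$-approximation for the MUWP finds a subset that can be completed by $\alpha D$ with unscheduled weight at most $\beta$ times the minimum for deadline $D$. A $\gamma$-approximation for the offline problem with identical release times outputs, for jobs all available at time $0$, a schedule of total weighted completion time at most $\gamma$ times optimal, and (by assumption) does not increase the makespan, so a set returned by the $(\alpha,\beta)$-approximation with deadline $D$ is scheduled within length $\alpha D$. Algorithm $\mathcal{A}'$: choose $X$ uniformly at random from $(0,1]$, let $\eta=2^{-X}$, and set interval endpoints $\tau_k=\eta 2^k$. At each $\tau_k$, let $R(\tau_k)$ be the set of jobs released but not yet scheduled by $\mathcal{A}'$ before $\tau_k$; run the $(\alpha,\beta)$-approximation on $R(\tau_k)$ with deadline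 $D=\tau_{k+1}-\tau_k$, obtaining $S_k$, and schedule $S_k$ in $[\alpha\tau_k,\alpha\tau_{k+1})$, starting at $\alpha\tau_k$, using the schedule of the $\gamma$-approximation (which ignores release times). *)

theory Defs
  imports "HOL-Probability.Probability"
begin

text \<open>
  A schedule tells how a job is processed at each point of time: \<open>None\<close> means that it is not being
  processed; the values of type \<open>'m\<close> are left to the environment (a machine, a set of machines,
  a rate, ...). As usual in scheduling, a job running from \<open>a\<close> to \<open>b\<close> is meant to be processed
  during \<open>[a, b)\<close>.
\<close>

type_synonym ('j, 'm) schedule = "'j \<Rightarrow> real \<Rightarrow> 'm option"

definition processed :: "('j, 'm) schedule \<Rightarrow> 'j \<Rightarrow> real set" where
  "processed \<sigma> j = {t. \<sigma> j t \<noteq> None}"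

definition start_time :: "('j, 'm) schedule \<Rightarrow> 'j \<Rightarrow> real" where
  "start_time \<sigma> j = Inf (processed \<sigma> j)"

definition completion_time :: "('j, 'm) schedule \<Rightarrow> 'j \<Rightarrow> real" where
  "completion_time \<sigma> j = Sup (processed \<sigma> j)"

definition delay :: "real \<Rightarrow> ('j, 'm) schedule \<Rightarrow> ('j, 'm) schedule" where
  "delay d \<sigma> = (\<lambda>j t. \<sigma> j (t - d))"

definition restrict_to :: "'j set \<Rightarrow> ('j, 'm) schedule \<Rightarrow> ('j, 'm) schedule" where
  "restrict_to S \<sigma> = (\<lambda>j t. if j \<in> S then \<sigma> j t else None)"

definition combine :: "'j set \<Rightarrow> ('j, 'm) schedule \<Rightarrow> ('j, 'm) schedule \<Rightarrow> ('j, 'm) schedule" where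
  "combine S \<sigma> \<rho> = (\<lambda>j t. if j \<in> S then \<sigma> j t else \<rho> j t)"

text \<open>
  \<open>valid S \<sigma>\<close> means that \<open>\<sigma>\<close> is a schedule of exactly the jobs in \<open>S\<close>, starting at time 0 or later
  and processing each of them to completion; release times are \<^emph>\<open>not\<close> taken into account.
  The processing time \<open>p j\<close> is the least time that can elapse between start and completion of \<open>j\<close>
  (so the model covers preemption, several machines per job, etc.).
\<close>

locale scheduling_environment =
  fixes J :: "'j set"
    and p :: "'j \<Rightarrow> real"
    and valid :: "'j set \<Rightarrow> ('j, 'm) schedule \<Rightarrow> bool"
  assumes finite_jobs: "finite J"
    and valid_subset: "valid S \<sigma> \<Longrightarrow> S \<subseteq> J"
    and processed_outside: "valid S \<sigma> \<Longrightarrow> j \<notin> S \<Longrightarrow> processed \<sigma> j = {}"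
    and processed_nonempty: "valid S \<sigma> \<Longrightarrow> j \<in> S \<Longrightarrow> processed \<sigma> j \<noteq> {}"
    and processed_nonneg: "valid S \<sigma> \<Longrightarrow> processed \<sigma> j \<subseteq> {0..}"
    and processed_bounded: "valid S \<sigma> \<Longrightarrow> bdd_above (processed \<sigma> j)"
    and processing_time: "valid S \<sigma> \<Longrightarrow> j \<in> S \<Longrightarrow> start_time \<sigma> j + p j \<le> completion_time \<sigma> j"
    and valid_restrict: "valid S \<sigma> \<Longrightarrow> T \<subseteq> S \<Longrightarrow> valid T (restrict_to T \<sigma>)"
    and valid_delay: "valid S \<sigma> \<Longrightarrow> 0 \<le> d \<Longrightarrow> valid S (delay d \<sigma>)"
    and valid_combine:
      "valid S \<sigma> \<Longrightarrow> valid T \<rho> \<Longrightarrow> S \<inter> T = {} \<Longrightarrow>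
       (\<And>i. i \<in> S \<Longrightarrow> completion_time \<sigma> i \<le> t) \<Longrightarrow> (\<And>j. j \<in> T \<Longrightarrow> t \<le> start_time \<rho> j) \<Longrightarrow>
       valid (S \<union> T) (combine S \<sigma> \<rho>)"

definition weighted_completion :: "('j \<Rightarrow> real) \<Rightarrow> 'j set \<Rightarrow> ('j, 'm) schedule \<Rightarrow> real" where
  "weighted_completion w S \<sigma> = (\<Sum>j\<in>S. w j * completion_time \<sigma> j)"

definition respects_release ::
    "('j \<Rightarrow> real) \<Rightarrow> 'j set \<Rightarrow> ('j, 'm) schedule \<Rightarrow> bool" where
  "respects_release r S \<sigma> \<longleftrightarrow> (\<forall>j\<in>S. processed \<sigma> j \<subseteq> {r j..})"

definition optimal_schedule ::
    "('j set \<Rightarrow> ('j, 'm) schedule \<Rightarrow> bool) \<Rightarrow> ('j \<Rightarrow> real) \<Rightarrow> ('j \<Rightarrow> real) \<Rightarrow> 'j set \<Rightarrow>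
     ('j, 'm) schedule \<Rightarrow> bool" where
  "optimal_schedule valid w r S \<sigma> \<longleftrightarrow>
     valid S \<sigma> \<and> respects_release r S \<sigma> \<and>
     (\<forall>\<rho>. valid S \<rho> \<and> respects_release r S \<rho> \<longrightarrow>
        weighted_completion w S \<sigma> \<le> weighted_completion w S \<rho>)"

definition completable_by ::
    "('j set \<Rightarrow> ('j, 'm) schedule \<Rightarrow> bool) \<Rightarrow> 'j set \<Rightarrow> real \<Rightarrow> bool" where
  "completable_by valid S D \<longleftrightarrow> (\<exists>\<sigma>. valid S \<sigma> \<and> (\<forall>j\<in>S. completion_time \<sigma> j \<le> D))"

text \<open>The minimum unscheduled weight problem (MUWP); all jobs are available at time 0.\<close>

definition min_unscheduled_weight ::
    "('j set \<Rightarrow> ('j, 'm) schedule \<Rightarrow> bool) \<Rightarrow> ('j \<Rightarrow> real) \<Rightarrow> 'j set \<Rightarrow> real \<Rightarrow> real" where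
  "min_unscheduled_weight valid w R D = Min {sum w (R - S) | S. S \<subseteq> R \<and> completable_by valid S D}"

definition muwp_approximation ::
    "('j set \<Rightarrow> ('j, 'm) schedule \<Rightarrow> bool) \<Rightarrow> ('j \<Rightarrow> real) \<Rightarrow> 'j set \<Rightarrow> real \<Rightarrow> real \<Rightarrow>
     ('j set \<Rightarrow> real \<Rightarrow> 'j set) \<Rightarrow> bool" where
  "muwp_approximation valid w J \<alpha> \<beta> select \<longleftrightarrow>
     (\<forall>R D. R \<subseteq> J \<and> 0 < D \<longrightarrow>
        select R D \<subseteq> R \<and>
        completable_by valid (select R D) (\<alpha> * D) \<and>
        sum w (R - select R D) \<le> \<beta> * min_unscheduled_weight valid w R D)"

definition offline_approximation ::
    "('j set \<Rightarrow> ('j, 'm) schedule \<Rightarrow> bool) \<Rightarrow> ('j \<Rightarrow> real) \<Rightarrow> 'j set \<Rightarrow> real \<Rightarrow>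
     ('j set \<Rightarrow> ('j, 'm) schedule) \<Rightarrow> bool" where
  "offline_approximation valid w J \<gamma> offline \<longleftrightarrow>
     (\<forall>S \<subseteq> J. valid S (offline S) \<and>
        weighted_completion w S (offline S) \<le>
          \<gamma> * (INF \<sigma>\<in>{\<sigma>. valid S \<sigma>}. weighted_completion w S \<sigma>))"

definition preserves_makespan ::
    "'j set \<Rightarrow> real \<Rightarrow> ('j set \<Rightarrow> real \<Rightarrow> 'j set) \<Rightarrow> ('j set \<Rightarrow> ('j, 'm) schedule) \<Rightarrow> bool" where
  "preserves_makespan J \<alpha> select offline \<longleftrightarrow>
     (\<forall>R D. R \<subseteq> J \<and> 0 < D \<longrightarrow>
        (\<forall>j \<in> select R D. completion_time (offline (select R D)) j \<le> \<alpha> * D))"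

text \<open>
  The run of the online algorithm for the value \<open>x\<close> of the random variable \<open>X\<close>. Here
  \<open>scheduled_before J r select x k\<close> is the set of jobs selected at \<open>\<tau>\<^sub>0, ..., \<tau>\<^bsub>k-1\<^esub>\<close>.
\<close>

definition endpoint :: "real \<Rightarrow> nat \<Rightarrow> real" where
  "endpoint x k = 2 powr (- x) * 2 ^ k"

primrec scheduled_before ::
    "'j set \<Rightarrow> ('j \<Rightarrow> real) \<Rightarrow> ('j set \<Rightarrow> real \<Rightarrow> 'j set) \<Rightarrow> real \<Rightarrow> nat \<Rightarrow> 'j set" where
  "scheduled_before J r select x 0 = {}"
| "scheduled_before J r select x (Suc k) =
     scheduled_before J r select x k \<union>
     select {j \<in> J. r j \<le> endpoint x k \<and> j \<notin> scheduled_before J r select x k}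
            (endpoint x (Suc k) - endpoint x k)"

definition pending ::
    "'j set \<Rightarrow> ('j \<Rightarrow> real) \<Rightarrow> ('j set \<Rightarrow> real \<Rightarrow> 'j set) \<Rightarrow> real \<Rightarrow> nat \<Rightarrow> 'j set" where
  "pending J r select x k =
     {j \<in> J. r j \<le> endpoint x k \<and> j \<notin> scheduled_before J r select x k}"

definition batch ::
    "'j set \<Rightarrow> ('j \<Rightarrow> real) \<Rightarrow> ('j set \<Rightarrow> real \<Rightarrow> 'j set) \<Rightarrow> real \<Rightarrow> nat \<Rightarrow> 'j set" where
  "batch J r select x k =
     select (pending J r select x k) (endpoint x (Suc k) - endpoint x k)"

text \<open>The batches are disjoint, so the choice of \<open>k\<close> below is unique.\<close>

definition online_schedule ::
    "'j set \<Rightarrow> ('j \<Rightarrow> real) \<Rightarrow> real \<Rightarrow> ('j set \<Rightarrow> real \<Rightarrow> 'j set) \<Rightarrow>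
     ('j set \<Rightarrow> ('j, 'm) schedule) \<Rightarrow> real \<Rightarrow> ('j, 'm) schedule" where
  "online_schedule J r \<alpha> select offline x = (\<lambda>j.
     if \<exists>k. j \<in> batch J r select x k then
       let k = (LEAST k. j \<in> batch J r select x k)
       in delay (\<alpha> * endpoint x k) (offline (batch J r select x k)) j
     else (\<lambda>t. None))"

text \<open>
  A job that is never scheduled has completion time \<open>\<infinity>\<close>. A correct approximation may omit jobs of
  weight 0 forever; they contribute \<open>0 * \<infinity> = 0\<close> to the cost.
\<close>

definition online_completion_time ::
    "'j set \<Rightarrow> ('j \<Rightarrow> real) \<Rightarrow> real \<Rightarrow> ('j set \<Rightarrow> real \<Rightarrow> 'j set) \<Rightarrow>
     ('j set \<Rightarrow> ('j, 'm) schedule) \<Rightarrow> real \<Rightarrow> 'j \<Rightarrow> ennreal" where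
  "online_completion_time J r \<alpha> select offline x j =
     (if \<exists>k. j \<in> batch J r select x k
      then ennreal (completion_time (online_schedule J r \<alpha> select offline x) j)
      else \<infinity>)"

definition online_cost ::
    "'j set \<Rightarrow> ('j \<Rightarrow> real) \<Rightarrow> ('j \<Rightarrow> real) \<Rightarrow> real \<Rightarrow> ('j set \<Rightarrow> real \<Rightarrow> 'j set) \<Rightarrow>
     ('j set \<Rightarrow> ('j, 'm) schedule) \<Rightarrow> real \<Rightarrow> ennreal" where
  "online_cost J w r \<alpha> select offline x =
     (\<Sum>j\<in>J. ennreal (w j) * online_completion_time J r \<alpha> select offline x j)"

end

theory Submission
  imports Defs
begin

text \<open>
  Let \<open>U\<^sub>k\<close> be the weight of the jobs not scheduled before \<open>\<tau>\<^sub>k\<close>. The pending jobs that the optimum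
  completes by \<open>\<tau>\<^sub>k\<close> are admissible for the MUWP solved at \<open>\<tau>\<^sub>k\<close>, so \<open>U\<^bsub>k+1\<^esub>\<close> is at most \<open>\<beta>\<close> times the
  weight of the jobs that the optimum completes after \<open>\<tau>\<^sub>k\<close>. A job of batch \<open>k\<close> is delayed by \<open>\<alpha> \<tau>\<^sub>k\<close>,
  and by Abel summation the total weighted delay is at most \<open>\<alpha> (W + \<beta> \<Sum>\<^sub>j w\<^sub>j h\<^sub>j)\<close>, where \<open>h\<^sub>j\<close> is the sum
  of the \<open>\<tau>\<^sub>k\<close> below the optimal completion time \<open>C\<^sub>j\<close>; its expectation is at most \<open>C\<^sub>j / ln 2\<close>. Within the
  batches, the offline schedules cost at most \<open>\<gamma>\<close> times the restrictions of the optimal schedule.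
  The cost itself need not be measurable in \<open>x\<close>, but the bound obtained for it is.
\<close>

section \<open>Completion times under delay and restriction\<close>

text \<open>The processed set is translated by \<open>d\<close>, and \<open>Sup\<close> commutes
  with translation on nonempty sets that are bounded above.\<close>

lemma completion_time_delay:
  assumes "processed \<sigma> j \<noteq> {}" and "bdd_above (processed \<sigma> j)"
  shows "completion_time (delay d \<sigma>) j = d + completion_time \<sigma> j"
proof -
  have img: "processed (delay d \<sigma>) j = (\<lambda>t. d + t) ` processed \<sigma> j"
    unfolding processed_def delay_def image_def
    by (auto intro!: exI[of _ "t - d" for t])
  show ?thesis
    unfolding completion_time_def img
  proof (rule cSup_eq_non_empty)
    show "(\<lambda>t. d + t) ` processed \<sigma> j \<noteq> {}"
      using assms(1) by simp
  next
    fix s assume "s \<in> (\<lambda>t. d + t) ` processed \<sigma> j"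
    then show "s \<le> d + Sup (processed \<sigma> j)"
      using assms(2) by (auto intro: cSup_upper)
  next
    fix s assume "\<And>t. t \<in> (\<lambda>t. d + t) ` processed \<sigma> j \<Longrightarrow> t \<le> s"
    then have "Sup (processed \<sigma> j) \<le> s - d"
      using assms(1) by (intro cSup_least) (auto simp: le_diff_eq add.commute)
    then show "d + Sup (processed \<sigma> j) \<le> s" by simp
  qed
qed

lemma completion_time_restrict:
  "j \<in> T \<Longrightarrow> completion_time (restrict_to T \<sigma>) j = completion_time \<sigma> j"
  by (simp add: completion_time_def processed_def restrict_to_def)

lemma weighted_completion_restrict:
  "weighted_completion w T (restrict_to T \<sigma>) = weighted_completion w T \<sigma>"
  by (simp add: weighted_completion_def completion_time_restrict)

section \<open>Comparison bounds in a scheduling environment\<close>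

context scheduling_environment
begin

lemma processed_le_completion_time:
  "valid S \<sigma> \<Longrightarrow> t \<in> processed \<sigma> j \<Longrightarrow> t \<le> completion_time \<sigma> j"
  unfolding completion_time_def by (intro cSup_upper processed_bounded)

lemma completion_time_nonneg:
  assumes "valid S \<sigma>" and "j \<in> S"
  shows "0 \<le> completion_time \<sigma> j"
proof -
  obtain t where t: "t \<in> processed \<sigma> j"
    using processed_nonempty[OF assms] by blast
  moreover from t have "0 \<le> t"
    using processed_nonneg[OF assms(1), of j] by auto
  ultimately show ?thesis
    using processed_le_completion_time[OF assms(1) t] by linarith
qed

lemma release_le_completion_time:
  assumes "valid S \<sigma>" and "respects_release r S \<sigma>" and "j \<in> S"
  shows "r j \<le> completion_time \<sigma> j"
proof -
  obtain t where t: "t \<in> processed \<sigma> j"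
    using processed_nonempty[OF assms(1,3)] by blast
  moreover from t have "r j \<le> t"
    using assms(2,3) unfolding respects_release_def by auto
  ultimately show ?thesis
    using processed_le_completion_time[OF assms(1) t] by linarith
qed

lemma min_unscheduled_weight_le:
  assumes "R \<subseteq> J" and "T \<subseteq> R" and "completable_by valid T D"
  shows "min_unscheduled_weight valid w R D \<le> sum w (R - T)"
  unfolding min_unscheduled_weight_def
proof (rule Min_le)
  have "finite (Pow R)"
    using assms(1) finite_jobs finite_subset by auto
  then have "finite ((\<lambda>S. sum w (R - S)) ` Pow R)" by simp
  then show "finite {sum w (R - S) |S. S \<subseteq> R \<and> completable_by valid S D}"
    by (rule rev_finite_subset) auto
qed (use assms in blast)

lemma completable_by_restrict:
  assumes "valid S \<sigma>" and "T \<subseteq> S" and "\<And>j. j \<in> T \<Longrightarrow> completion_time \<sigma> j \<le> D"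
  shows "completable_by valid T D"
  unfolding completable_by_def
  using valid_restrict[OF assms(1,2)] assms(3)
  by (auto simp: completion_time_restrict intro!: exI[of _ "restrict_to T \<sigma>"])

text \<open>The restriction of \<open>\<sigma>\<close> to \<open>S\<close> is one of the competitors
  in the infimum, and it keeps the completion times of the jobs in \<open>S\<close>. Nonnegative
  costs make the infimum bounded below.\<close>

lemma weighted_completion_offline_le:
  assumes "offline_approximation valid w J \<gamma> offline" and "0 \<le> \<gamma>"
    and "\<And>j. j \<in> J \<Longrightarrow> 0 \<le> w j"
    and "valid J \<sigma>" and "S \<subseteq> J"
  shows "weighted_completion w S (offline S) \<le> \<gamma> * weighted_completion w S \<sigma>"
proof -
  have "(INF \<rho>\<in>{\<rho>. valid S \<rho>}. weighted_completion w S \<rho>)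
      \<le> weighted_completion w S (restrict_to S \<sigma>)"
  proof (rule cINF_lower)
    show "bdd_below (weighted_completion w S ` {\<rho>. valid S \<rho>})"
      unfolding weighted_completion_def using assms(3,5) completion_time_nonneg
      by (intro bdd_belowI[of _ 0]) (force intro!: sum_nonneg mult_nonneg_nonneg)
  qed (simp add: valid_restrict[OF assms(4,5)])
  moreover have "weighted_completion w S (offline S)
      \<le> \<gamma> * (INF \<rho>\<in>{\<rho>. valid S \<rho>}. weighted_completion w S \<rho>)"
    using assms(1,5) unfolding offline_approximation_def by blast
  ultimately show ?thesis
    using mult_left_mono[OF _ assms(2)] by (fastforce simp: weighted_completion_restrict)
qed

end

section \<open>Interval endpoints, batches and Abel summation\<close>

lemma endpoint_pos: "0 < endpoint x k"
  by (simp add: endpoint_def)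

lemma endpoint_Suc: "endpoint x (Suc k) = 2 * endpoint x k"
  by (simp add: endpoint_def)

lemma endpoint_0_le: "0 \<le> x \<Longrightarrow> endpoint x 0 \<le> 1"
  by (simp add: endpoint_def powr_le_one_le powr_minus ge_one_powr_ge_zero divide_simps)

text \<open>This bound does not depend on \<open>x\<close>, so the number of batches to consider can
  be fixed before \<open>x\<close> is drawn.\<close>

lemma endpoint_ge:
  assumes "x \<le> 1"
  shows "2 ^ k / 2 \<le> endpoint x k"
proof -
  have "(2::real) powr (-1) \<le> 2 powr (-x)"
    using assms by (intro powr_mono) auto
  then show ?thesis
    by (simp add: endpoint_def powr_minus field_simps)
qed

lemma endpoint_powr: "endpoint x k = 2 powr (real k - x)"
  by (simp add: endpoint_def powr_diff powr_minus powr_realpow field_simps)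

lemma scheduled_before_Suc:
  "scheduled_before J r select x (Suc k) =
     scheduled_before J r select x k \<union> batch J r select x k"
  by (simp add: batch_def pending_def)

lemma scheduled_before_UN:
  "scheduled_before J r select x k = (\<Union>i<k. batch J r select x i)"
  by (induction k) (auto simp: scheduled_before_Suc lessThan_Suc simp del: scheduled_before.simps(2))

text \<open>Abel summation: with \<open>U k\<close> the weight left before batch \<open>k\<close>,
  the weight of that batch is the drop \<open>U k - U (Suc k)\<close>.\<close>

lemma sum_parts_telescope:
  fixes \<tau> U :: "nat \<Rightarrow> real"
  shows "(\<Sum>k<Suc n. \<tau> k * (U k - U (Suc k))) =
    \<tau> 0 * U 0 + (\<Sum>k<n. (\<tau> (Suc k) - \<tau> k) * U (Suc k)) - \<tau> n * U (Suc n)"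
  by (induction n) (simp_all add: algebra_simps)

section \<open>Expected sum of the endpoints below a threshold\<close>

text \<open>
  The random variable \<open>y = k - x\<close> sweeps the half-line \<open>[-1, \<infinity>)\<close> as \<open>k\<close> and \<open>x\<close> vary, so the sum
  below has expectation at most \<open>\<integral> 2 powr y dy\<close> over \<open>2 powr y < C\<close>.  The bound for a single \<open>k\<close>
  is the increment of \<open>min (2 powr y) C / ln 2\<close> from \<open>k - 1\<close> to \<open>k\<close>.
\<close>

lemma nn_integral_endpoint_less:
  assumes "0 < C"
  shows "(\<integral>\<^sup>+ x. ennreal (if endpoint x k < C then endpoint x k else 0) * indicator {0<..1} x \<partial>lborel)
    \<le> ennreal ((min (2 ^ k) C - min (2 ^ k / 2) C) / ln 2)"
proof -
  \<comment> \<open>\<open>endpoint x k < C\<close> holds exactly for \<open>x\<close> above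
    \<open>real k - log 2 C\<close>; \<open>c\<close> clamps this threshold to the unit
    interval.\<close>
  define c where "c = max 0 (min 1 (real k - log 2 C))"
  define F where "F x = - (2 powr (real k - x)) / ln 2" for x :: real
  have c: "0 \<le> c" "c \<le> 1" by (auto simp: c_def)
  have less_iff: "endpoint x k < C \<longleftrightarrow> real k - log 2 C < x" for x
    using assms by (auto simp: endpoint_powr powr_less_iff algebra_simps less_log_iff)
  have "(\<integral>\<^sup>+ x. ennreal (if endpoint x k < C then endpoint x k else 0) * indicator {0<..1} x \<partial>lborel)
      \<le> (\<integral>\<^sup>+ x. ennreal (2 powr (real k - x)) * indicator {c..1} x \<partial>lborel)"
    unfolding less_iff
    by (intro nn_integral_mono) (auto simp: endpoint_powr c_def split: split_indicator)
  also have "\<dots> = ennreal (F 1 - F c)"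
  proof (rule nn_integral_FTC_Icc)
    show "(F has_real_derivative 2 powr (real k - x)) (at x)" for x
      unfolding F_def powr_def by (auto intro!: derivative_eq_intros)
  qed (use c in auto)
  also have "F 1 - F c = (2 powr (real k - c) - 2 ^ k / 2) / ln 2"
    by (simp add: F_def powr_diff powr_realpow diff_divide_distrib)
  also have "ennreal \<dots> \<le> ennreal ((min (2 ^ k) C - min (2 ^ k / 2) C) / ln 2)"
  proof (intro ennreal_leI divide_right_mono)
    have log_powr: "2 powr log 2 C = C" using assms by simp
    have k_powr: "2 powr real k = (2::real) ^ k" by (simp add: powr_realpow)
    \<comment> \<open>With the threshold left of the interval, both minima are attained by the
      powers of 2; right of it, \<open>c = 1\<close> makes the left side 0; inside it,
      \<open>2 powr (real k - c)\<close> is \<open>C\<close> itself.\<close>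
    consider "real k - log 2 C \<le> 0" | "1 \<le> real k - log 2 C"
      | "0 < real k - log 2 C" "real k - log 2 C < 1" by linarith
    then show "2 powr (real k - c) - 2 ^ k / 2 \<le> min (2 ^ k) C - min (2 ^ k / 2) C"
    proof cases
      case 1
      then have "2 powr real k \<le> 2 powr log 2 C" by simp
      then have "2 ^ k \<le> C" by (simp only: log_powr k_powr)
      moreover from 1 have "c = 0" by (simp add: c_def)
      moreover have "(0::real) < 2 ^ k" by simp
      ultimately show ?thesis by (simp add: k_powr)
    next
      case 2
      then have "c = 1" by (simp add: c_def)
      moreover have "min (2 ^ k / 2) C \<le> min (2 ^ k) C"
        by (intro min.mono) auto
      ultimately show ?thesis by (simp add: powr_diff k_powr)
    next
      case 3
      then have c_eq: "c = real k - log 2 C" by (simp add: c_def)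
      from 3 have "2 powr log 2 C \<le> 2 powr real k" "2 powr (real k - 1) \<le> 2 powr log 2 C"
        by simp_all
      then have "C \<le> 2 ^ k" "2 ^ k / 2 \<le> C"
        by (simp_all only: log_powr k_powr powr_diff powr_one)
      then show ?thesis by (simp add: c_eq log_powr)
    qed
  qed simp
  finally show ?thesis .
qed

text \<open>The bounds for the single \<open>k\<close> telescope, which leaves at most
  \<open>C / ln 2\<close> whatever \<open>n\<close> is.\<close>

lemma nn_integral_sum_endpoint_less:
  assumes "0 \<le> C"
  shows "(\<integral>\<^sup>+ x. (\<Sum>k<n. ennreal (if endpoint x k < C then endpoint x k else 0))
      \<partial>uniform_measure lborel {0<..1}) \<le> ennreal (C / ln 2)"
proof (cases "C = 0")
  case True
  then show ?thesis by (simp add: order_less_not_sym[OF endpoint_pos])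
next
  case False
  with assms have C: "0 < C" by simp
  \<comment> \<open>\<open>G (Suc k)\<close> is the minimum of \<open>2 ^ k\<close> and
    \<open>C\<close> over \<open>ln 2\<close>, so \<open>G (Suc k) - G k\<close> is exactly the
    bound for a single \<open>k\<close>.\<close>
  define G where "G k = min (2 ^ k / 2) C / ln 2" for k :: nat
  have meas [measurable]:
    "(\<lambda>x. ennreal (if endpoint x k < C then endpoint x k else 0)) \<in> borel_measurable borel" for k
    unfolding endpoint_def by measurable
  have "(\<integral>\<^sup>+ x. (\<Sum>k<n. ennreal (if endpoint x k < C then endpoint x k else 0))
      \<partial>uniform_measure lborel {0<..1}) =
    (\<Sum>k<n. \<integral>\<^sup>+ x. ennreal (if endpoint x k < C then endpoint x k else 0)
      * indicator {0<..1} x \<partial>lborel)"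
    by (simp add: nn_integral_uniform_measure sum_distrib_right nn_integral_sum divide_ennreal_def
        del: sum_ennreal)
  also have "\<dots> \<le> (\<Sum>k<n. ennreal (G (Suc k) - G k))"
    using nn_integral_endpoint_less[OF C]
    by (intro sum_mono) (simp add: G_def diff_divide_distrib)
  also have "\<dots> = ennreal (\<Sum>k<n. G (Suc k) - G k)"
  proof (rule sum_ennreal)
    show "0 \<le> G (Suc k) - G k" for k
      unfolding G_def diff_ge_0_iff_ge by (intro divide_right_mono min.mono) auto
  qed
  also have "\<dots> \<le> ennreal (C / ln 2)"
  proof (rule ennreal_leI)
    have "G n \<le> C / ln 2" "0 \<le> G 0"
      unfolding G_def using C by (auto intro!: divide_right_mono)
    then show "(\<Sum>k<n. G (Suc k) - G k) \<le> C / ln 2"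
      by (simp add: sum_lessThan_telescope)
  qed
  finally show ?thesis .
qed

section \<open>Batches and the weight they leave unscheduled\<close>

locale online_run = scheduling_environment J p valid
  for J :: "'j set" and p :: "'j \<Rightarrow> real" and valid :: "'j set \<Rightarrow> ('j, 'm) schedule \<Rightarrow> bool" +
  fixes w r :: "'j \<Rightarrow> real" and \<alpha> \<beta> \<gamma> :: real
    and select :: "'j set \<Rightarrow> real \<Rightarrow> 'j set"
    and offline :: "'j set \<Rightarrow> ('j, 'm) schedule"
    and opt :: "('j, 'm) schedule"
  assumes weight_nonneg: "\<And>j. j \<in> J \<Longrightarrow> 0 \<le> w j"
    and alpha_nonneg: "0 \<le> \<alpha>" and beta_ge_1: "1 \<le> \<beta>" and gamma_nonneg: "0 \<le> \<gamma>"
    and muwp: "muwp_approximation valid w J \<alpha> \<beta> select"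
    and offline: "offline_approximation valid w J \<gamma> offline"
    and opt_valid: "valid J opt" and opt_release: "respects_release r J opt"
begin

abbreviation "scheduled \<equiv> scheduled_before J r select"
abbreviation "S \<equiv> batch J r select"
abbreviation "C \<equiv> completion_time opt"
abbreviation "unscheduled_weight x k \<equiv> sum w (J - scheduled x k)"

lemma endpoint_gap_pos: "0 < endpoint x (Suc k) - endpoint x k"
  using endpoint_pos[of x k] by (simp add: endpoint_Suc)

lemma pending_subset: "pending J r select x k \<subseteq> J"
  by (auto simp: pending_def)

lemma batch_subset_pending: "S x k \<subseteq> pending J r select x k"
  using muwp pending_subset endpoint_gap_pos
  unfolding muwp_approximation_def batch_def by metis

lemma batch_subset: "S x k \<subseteq> J"
  using batch_subset_pending pending_subset by blast

lemma batch_not_scheduled: "S x k \<inter> scheduled x k = {}"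
  using batch_subset_pending by (force simp: pending_def)

lemma batch_disjoint: "i \<noteq> k \<Longrightarrow> S x i \<inter> S x k = {}"
proof (induction i k rule: linorder_wlog)
  case (le i k)
  then have "S x i \<subseteq> scheduled x k" unfolding scheduled_before_UN by (intro UN_upper) auto
  then show ?case using batch_not_scheduled[of x k] by blast
qed blast

lemma completion_nonneg: "j \<in> J \<Longrightarrow> 0 \<le> C j"
  using completion_time_nonneg[OF opt_valid] .

text \<open>
  The pending jobs that the optimum completes by \<open>\<tau>\<^sub>k\<close> fit into the deadline \<open>\<tau>\<^bsub>k+1\<^esub> - \<tau>\<^sub>k = \<tau>\<^sub>k\<close>;
  the jobs not yet released at \<open>\<tau>\<^sub>k\<close> are completed after \<open>\<tau>\<^sub>k\<close> by the optimum as well.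
\<close>

lemma unscheduled_weight_Suc_le:
  "unscheduled_weight x (Suc k) \<le> \<beta> * (\<Sum>j\<in>J. if endpoint x k < C j then w j else 0)"
proof -
  define R where "R = pending J r select x k"
  define T where "T = {j \<in> R. C j \<le> endpoint x k}"
  define V where "V = {j \<in> J. endpoint x k < r j \<and> j \<notin> scheduled x k}"
  have R: "R \<subseteq> J" unfolding R_def by (rule pending_subset)
  have fin: "finite R" "finite V"
    using R finite_jobs finite_subset by (auto simp: V_def)
  have V_late: "endpoint x k < C j" if "j \<in> V" for j
    using release_le_completion_time[OF opt_valid opt_release, of j] that by (auto simp: V_def)
  have disj: "R \<inter> V = {}" by (auto simp: R_def V_def pending_def)
  have w_V: "0 \<le> sum w V" using weight_nonneg by (intro sum_nonneg) (auto simp: V_def)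
  have gap: "endpoint x (Suc k) - endpoint x k = endpoint x k" by (simp add: endpoint_Suc)
  have T: "completable_by valid T (endpoint x k)"
    using R by (intro completable_by_restrict[OF opt_valid]) (auto simp: T_def)
  have "sum w (R - S x k) \<le> \<beta> * min_unscheduled_weight valid w R (endpoint x k)"
    using muwp R endpoint_pos[of x k]
    unfolding muwp_approximation_def batch_def R_def[symmetric] gap by blast
  also have "\<dots> \<le> \<beta> * sum w (R - T)"
    using beta_ge_1 T by (intro mult_left_mono min_unscheduled_weight_le R) (auto simp: T_def)
  finally have R_le: "sum w (R - S x k) \<le> \<beta> * sum w (R - T)" .
  have "J - scheduled x (Suc k) = (R - S x k) \<union> V"
    using batch_subset_pending[of x k]
    by (auto simp: scheduled_before_Suc R_def V_def pending_def simp del: scheduled_before.simps(2))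
  then have "unscheduled_weight x (Suc k) = sum w (R - S x k) + sum w V"
    using disj fin by (simp add: sum.union_disjoint Diff_Int_distrib2)
  \<comment> \<open>The jobs in \<open>V\<close> lie outside the MUWP instance and enter with factor
    1; \<open>\<beta>\<close> \<ge> 1 lets them share the factor \<open>\<beta>\<close>.\<close>
  also have "\<dots> \<le> \<beta> * sum w (R - T) + \<beta> * sum w V"
    using R_le mult_right_mono[OF beta_ge_1 w_V] by simp
  also have "\<dots> = \<beta> * sum w ((R - T) \<union> V)"
    using disj fin by (simp add: sum.union_disjoint Diff_Int_distrib2 distrib_left)
  also have "\<dots> \<le> \<beta> * sum w {j \<in> J. endpoint x k < C j}"
    using beta_ge_1 R V_late weight_nonneg finite_jobs
    by (intro mult_left_mono sum_mono2) (auto simp: T_def V_def)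
  also have "sum w {j \<in> J. endpoint x k < C j} = (\<Sum>j\<in>J. if endpoint x k < C j then w j else 0)"
    using finite_jobs by (simp add: sum.inter_filter)
  finally show ?thesis .
qed

section \<open>Cost of the online schedule for a fixed \<open>x\<close>\<close>

lemma unscheduled_weight_nonneg: "0 \<le> unscheduled_weight x k"
  using weight_nonneg by (intro sum_nonneg) auto

lemma batch_weight: "sum w (S x k) = unscheduled_weight x k - unscheduled_weight x (Suc k)"
proof -
  have "J - scheduled x k = (J - scheduled x (Suc k)) \<union> S x k"
    "(J - scheduled x (Suc k)) \<inter> S x k = {}"
    using batch_subset[of x k] batch_not_scheduled[of x k]
    by (auto simp: scheduled_before_Suc simp del: scheduled_before.simps(2))
  then have "unscheduled_weight x k = unscheduled_weight x (Suc k) + sum w (S x k)"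
    using finite_jobs finite_subset[OF batch_subset[of x k]] by (simp add: sum.union_disjoint)
  then show ?thesis by simp
qed

text \<open>Abel summation replaces batch weights by unscheduled weights. As endpoints double, the
  gap after \<open>endpoint x k\<close> is \<open>endpoint x k\<close> itself, and
  \<open>endpoint x 0\<close> \<le> 1 turns the boundary term into \<open>sum w J\<close>.\<close>

lemma batch_start_cost_le:
  assumes "0 \<le> x"
  shows "(\<Sum>k<Suc n. endpoint x k * sum w (S x k)) \<le>
    sum w J + \<beta> * (\<Sum>j\<in>J. w j * (\<Sum>k<n. if endpoint x k < C j then endpoint x k else 0))"
proof -
  \<comment> \<open>The subtracted boundary term of the summation by parts is nonnegative and is
    dropped.\<close>
  have "(\<Sum>k<Suc n. endpoint x k * sum w (S x k)) \<le>
      endpoint x 0 * sum w J + (\<Sum>k<n. endpoint x k * unscheduled_weight x (Suc k))"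
    unfolding batch_weight sum_parts_telescope[of "endpoint x" "\<lambda>k. unscheduled_weight x k"]
    using mult_nonneg_nonneg[OF less_imp_le[OF endpoint_pos[of x n]]
        unscheduled_weight_nonneg[of x "Suc n"]]
    by (simp add: endpoint_Suc del: scheduled_before.simps(2))
  also have "\<dots> \<le> sum w J + (\<Sum>k<n. endpoint x k *
      (\<beta> * (\<Sum>j\<in>J. if endpoint x k < C j then w j else 0)))"
    using endpoint_0_le[OF assms] weight_nonneg less_imp_le[OF endpoint_pos]
    by (intro add_mono sum_mono mult_left_mono unscheduled_weight_Suc_le mult_left_le_one_le)
       (auto intro!: sum_nonneg)
  also have "(\<Sum>k<n. endpoint x k * (\<beta> * (\<Sum>j\<in>J. if endpoint x k < C j then w j else 0))) =
      \<beta> * (\<Sum>k<n. \<Sum>j\<in>J. w j * (if endpoint x k < C j then endpoint x k else 0))"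
    unfolding sum_distrib_left by (intro sum.cong) (auto simp: mult_ac)
  also have "(\<Sum>k<n. \<Sum>j\<in>J. w j * (if endpoint x k < C j then endpoint x k else 0)) =
      (\<Sum>j\<in>J. w j * (\<Sum>k<n. if endpoint x k < C j then endpoint x k else 0))"
    unfolding sum_distrib_left by (rule sum.swap)
  finally show ?thesis .
qed

lemma online_completion_time_batch:
  assumes "j \<in> S x k"
  shows "online_completion_time J r \<alpha> select offline x j =
    ennreal (\<alpha> * endpoint x k + completion_time (offline (S x k)) j)"
proof -
  have valid: "valid (S x k) (offline (S x k))"
    using offline batch_subset unfolding offline_approximation_def by blast
  have "(LEAST k. j \<in> S x k) = k"
  proof (rule Least_equality)
    show "k \<le> i" if "j \<in> S x i" for i
      using batch_disjoint[of i k x] assms that by (cases "i = k") auto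
  qed (rule assms)
  then have "online_schedule J r \<alpha> select offline x j =
      delay (\<alpha> * endpoint x k) (offline (S x k)) j"
    using assms by (auto simp: online_schedule_def)
  then have "completion_time (online_schedule J r \<alpha> select offline x) j =
      completion_time (delay (\<alpha> * endpoint x k) (offline (S x k))) j"
    by (simp add: completion_time_def processed_def)
  also have "\<dots> = \<alpha> * endpoint x k + completion_time (offline (S x k)) j"
    using valid assms by (intro completion_time_delay processed_nonempty processed_bounded)
  finally show ?thesis
    using assms by (auto simp: online_completion_time_def)
qed

text \<open>When no weight is left after \<open>n\<close> batches, every job outside them has weight
  0, so even an infinite completion time contributes 0 and the cost is a finite real sum.\<close>

lemma online_cost_eq:
  assumes "unscheduled_weight x n = 0"
  shows "online_cost J w r \<alpha> select offline x =
    ennreal (\<Sum>k<n. \<Sum>j\<in>S x k. w j * (\<alpha> * endpoint x k + completion_time (offline (S x k)) j))"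
proof -
  have sched: "scheduled x n \<subseteq> J"
    using batch_subset by (auto simp: scheduled_before_UN)
  have nonneg: "0 \<le> \<alpha> * endpoint x k + completion_time (offline (S x k)) j"
    if "j \<in> S x k" for j k
    using offline batch_subset that alpha_nonneg less_imp_le[OF endpoint_pos]
    unfolding offline_approximation_def
    by (intro add_nonneg_nonneg mult_nonneg_nonneg completion_time_nonneg[of "S x k"]) auto
  have "w j = 0" if "j \<in> J - scheduled x n" for j
    using assms that finite_jobs weight_nonneg by (subst (asm) sum_nonneg_eq_0_iff) auto
  then have "online_cost J w r \<alpha> select offline x =
      (\<Sum>j\<in>scheduled x n. ennreal (w j) * online_completion_time J r \<alpha> select offline x j)"
    unfolding online_cost_def using finite_jobs sched by (intro sum.mono_neutral_right) auto
  also have "\<dots> = (\<Sum>k<n. \<Sum>j\<in>S x k.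
      ennreal (w j) * online_completion_time J r \<alpha> select offline x j)"
    unfolding scheduled_before_UN using batch_disjoint finite_subset[OF batch_subset finite_jobs]
    by (intro sum.UNION_disjoint) auto
  also have "\<dots> = (\<Sum>k<n. \<Sum>j\<in>S x k.
      ennreal (w j * (\<alpha> * endpoint x k + completion_time (offline (S x k)) j)))"
    using weight_nonneg batch_subset nonneg
    by (intro sum.cong refl) (simp add: online_completion_time_batch ennreal_mult' subset_iff)
  also have "\<dots> = ennreal (\<Sum>k<n. \<Sum>j\<in>S x k.
      w j * (\<alpha> * endpoint x k + completion_time (offline (S x k)) j))"
  proof -
    have "0 \<le> w j * (\<alpha> * endpoint x k + completion_time (offline (S x k)) j)"
      if "j \<in> S x k" for j k
      using nonneg[OF that] weight_nonneg batch_subset that by (intro mult_nonneg_nonneg) auto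
    then show ?thesis
      by (simp only: sum_ennreal sum_nonneg)
  qed
  finally show ?thesis .
qed

text \<open>Each batch is charged to the same jobs in \<open>opt\<close>. Since the batches are
  disjoint subsets of \<open>J\<close>, the charges add up to at most the whole cost of
  \<open>opt\<close>.\<close>

lemma offline_cost_le:
  "(\<Sum>k<n. weighted_completion w (S x k) (offline (S x k))) \<le> \<gamma> * weighted_completion w J opt"
proof -
  have "(\<Sum>k<n. weighted_completion w (S x k) (offline (S x k)))
      \<le> (\<Sum>k<n. \<gamma> * weighted_completion w (S x k) opt)"
    using weight_nonneg batch_subset
    by (intro sum_mono weighted_completion_offline_le[OF offline gamma_nonneg _ opt_valid]) auto
  also have "\<dots> = \<gamma> * (\<Sum>k<n. weighted_completion w (S x k) opt)"
    by (simp add: sum_distrib_left)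
  also have "(\<Sum>k<n. weighted_completion w (S x k) opt) =
      weighted_completion w (\<Union>k<n. S x k) opt"
    unfolding weighted_completion_def
    using batch_disjoint finite_subset[OF batch_subset finite_jobs]
    by (intro sum.UNION_disjoint[symmetric]) auto
  also have "\<gamma> * \<dots> \<le> \<gamma> * weighted_completion w J opt"
    unfolding weighted_completion_def
    using gamma_nonneg batch_subset weight_nonneg completion_nonneg finite_jobs
    by (intro mult_left_mono sum_mono2) auto
  finally show ?thesis .
qed

lemma online_cost_le:
  assumes "0 \<le> x" and "x \<le> 1" and n: "\<And>j. j \<in> J \<Longrightarrow> C j \<le> 2 ^ n / 2"
  shows "online_cost J w r \<alpha> select offline x \<le>
    ennreal (\<gamma> * weighted_completion w J opt + \<alpha> * sum w J +
      \<alpha> * \<beta> * (\<Sum>j\<in>J. w j * (\<Sum>k<n. if endpoint x k < C j then endpoint x k else 0)))"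
proof -
  \<comment> \<open>As \<open>2 ^ n / 2\<close> \<le> \<open>endpoint x n\<close>,
    \<open>opt\<close> completes every job by \<open>endpoint x n\<close>. Batches \<open>0\<close>
    to \<open>n\<close> therefore leave weight 0, hence the \<open>Suc n\<close> below.\<close>
  have "\<not> endpoint x n < C j" if "j \<in> J" for j
    using n[OF that] endpoint_ge[OF assms(2), of n] by linarith
  then have "(\<Sum>j\<in>J. if endpoint x n < C j then w j else 0) = 0"
    by (intro sum.neutral) auto
  then have "unscheduled_weight x (Suc n) = 0"
    using unscheduled_weight_Suc_le[of x n] unscheduled_weight_nonneg[of x "Suc n"] by simp
  then have "online_cost J w r \<alpha> select offline x =
    ennreal (\<Sum>k<Suc n. \<Sum>j\<in>S x k. w j * (\<alpha> * endpoint x k + completion_time (offline (S x k)) j))"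
    by (rule online_cost_eq)
  also have "(\<Sum>k<Suc n. \<Sum>j\<in>S x k.
      w j * (\<alpha> * endpoint x k + completion_time (offline (S x k)) j)) =
    (\<Sum>k<Suc n. weighted_completion w (S x k) (offline (S x k))) +
    \<alpha> * (\<Sum>k<Suc n. endpoint x k * sum w (S x k))"
    unfolding weighted_completion_def sum_distrib_left sum.distrib[symmetric]
    by (intro sum.cong refl) (simp add: algebra_simps)
  also have "ennreal \<dots> \<le> ennreal (\<gamma> * weighted_completion w J opt + \<alpha> * (sum w J +
      \<beta> * (\<Sum>j\<in>J. w j * (\<Sum>k<n. if endpoint x k < C j then endpoint x k else 0))))"
    using alpha_nonneg assms(1)
    by (intro ennreal_leI add_mono mult_left_mono offline_cost_le batch_start_cost_le)
  finally show ?thesis by (simp add: algebra_simps)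
qed

section \<open>Expectation over the random shift\<close>

lemma expected_online_cost_le:
  "(\<integral>\<^sup>+ x. online_cost J w r \<alpha> select offline x \<partial>uniform_measure lborel {0<..1})
    \<le> ennreal ((1 / ln 2 * \<alpha> * \<beta> + \<gamma>) * weighted_completion w J opt + \<alpha> * sum w J)"
proof -
  let ?M = "uniform_measure lborel {0<..1::real}"
  let ?h = "\<lambda>n x j. \<Sum>k<n. if endpoint x k < C j then endpoint x k else 0"
  interpret M: prob_space ?M by (rule prob_space_uniform_measure) auto
  \<comment> \<open>Each \<open>2 * C j\<close> is at most the sum of all of them, so one
    \<open>n\<close> serves every job and every \<open>x\<close>.\<close>
  obtain n where n: "(\<Sum>j\<in>J. 2 * C j) < 2 ^ n"
    using real_arch_pow[of 2] by auto
  have n': "C j \<le> 2 ^ n / 2" if "j \<in> J" for j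
    using member_le_sum[of j J "\<lambda>j. 2 * C j"] that n completion_nonneg finite_jobs by fastforce
  define A where "A = \<gamma> * weighted_completion w J opt + \<alpha> * sum w J"
  have A: "0 \<le> A"
    unfolding A_def weighted_completion_def
    using gamma_nonneg alpha_nonneg weight_nonneg completion_nonneg
    by (intro add_nonneg_nonneg mult_nonneg_nonneg sum_nonneg) auto
  have h: "0 \<le> ?h n x j" for x j
    using less_imp_le[OF endpoint_pos] by (intro sum_nonneg) auto
  have coeff: "0 \<le> \<alpha> * \<beta> * w j" if "j \<in> J" for j
    using alpha_nonneg beta_ge_1 weight_nonneg[OF that] by simp
  have meas [measurable]:
    "(\<lambda>x. \<Sum>k<n. ennreal (if endpoint x k < C j then endpoint x k else 0)) \<in> borel_measurable borel"
    for j unfolding endpoint_def by measurable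
  have "(\<integral>\<^sup>+ x. online_cost J w r \<alpha> select offline x \<partial>?M)
      \<le> (\<integral>\<^sup>+ x. ennreal A + (\<Sum>j\<in>J. ennreal (\<alpha> * \<beta> * w j) *
          (\<Sum>k<n. ennreal (if endpoint x k < C j then endpoint x k else 0))) \<partial>?M)"
  \<comment> \<open>The bound for a fixed \<open>x\<close> is needed only on \<open>{0<..1}\<close>,
    which carries the whole measure.\<close>
  proof (intro nn_integral_mono_AE AE_uniform_measureI AE_I2 impI)
    fix x :: real assume x: "x \<in> {0<..1}"
    have "online_cost J w r \<alpha> select offline x \<le>
        ennreal (A + (\<Sum>j\<in>J. (\<alpha> * \<beta> * w j) * ?h n x j))"
      using online_cost_le[of x n] x n' by (simp add: A_def sum_distrib_left mult.assoc)
    also have "\<dots> = ennreal A + (\<Sum>j\<in>J. ennreal (\<alpha> * \<beta> * w j) * ennreal (?h n x j))"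
      using A h coeff
      by (simp add: sum_nonneg mult_nonneg_nonneg ennreal_mult[symmetric])
    also have "(\<lambda>j. ennreal (?h n x j)) =
        (\<lambda>j. \<Sum>k<n. ennreal (if endpoint x k < C j then endpoint x k else 0))"
      using less_imp_le[OF endpoint_pos] by (intro ext sum_ennreal[symmetric]) auto
    finally show "online_cost J w r \<alpha> select offline x \<le> ennreal A +
        (\<Sum>j\<in>J. ennreal (\<alpha> * \<beta> * w j) *
          (\<Sum>k<n. ennreal (if endpoint x k < C j then endpoint x k else 0)))" .
  qed auto
  \<comment> \<open>Linearity is applied to the measurable dominating function: the integral splits
    job by job, and the constant \<open>A\<close> is kept because the measure is a
    probability.\<close>
  also have "\<dots> = ennreal A + (\<Sum>j\<in>J. ennreal (\<alpha> * \<beta> * w j) *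
      (\<integral>\<^sup>+ x. (\<Sum>k<n. ennreal (if endpoint x k < C j then endpoint x k else 0)) \<partial>?M))"
    by (simp add: nn_integral_add nn_integral_sum nn_integral_cmult M.emeasure_space_1
        del: space_uniform_measure)
  also have "\<dots> \<le> ennreal A + (\<Sum>j\<in>J. ennreal (\<alpha> * \<beta> * w j) * ennreal (C j / ln 2))"
    using completion_nonneg
    by (intro add_left_mono sum_mono mult_left_mono nn_integral_sum_endpoint_less) auto
  also have "\<dots> = ennreal (A + (\<Sum>j\<in>J. \<alpha> * \<beta> * w j * (C j / ln 2)))"
    using A coeff completion_nonneg
    by (simp add: sum_nonneg ennreal_mult[symmetric])
  also have "(\<Sum>j\<in>J. \<alpha> * \<beta> * w j * (C j / ln 2)) =
      1 / ln 2 * \<alpha> * \<beta> * weighted_completion w J opt"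
    by (simp add: weighted_completion_def sum_distrib_left mult_ac)
  also have "A + \<dots> = (1 / ln 2 * \<alpha> * \<beta> + \<gamma>) * weighted_completion w J opt + \<alpha> * sum w J"
    by (simp add: A_def distrib_right)
  finally show ?thesis .
qed

end

theorem theorem2:
  fixes J :: "'j set"
    and w r p :: "'j \<Rightarrow> real"
    and valid :: "'j set \<Rightarrow> ('j, 'm) schedule \<Rightarrow> bool"
    and \<alpha> \<beta> \<gamma> :: real
    and select :: "'j set \<Rightarrow> real \<Rightarrow> 'j set"
    and offline :: "'j set \<Rightarrow> ('j, 'm) schedule"
    and opt :: "('j, 'm) schedule"
  assumes "scheduling_environment J p valid"
    and "\<And>j. j \<in> J \<Longrightarrow> 0 \<le> w j"
    and "\<And>j. j \<in> J \<Longrightarrow> 0 \<le> r j"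
    and "\<And>j. j \<in> J \<Longrightarrow> 1 \<le> p j"
    and "1 \<le> \<alpha>" and "1 \<le> \<beta>" and "1 \<le> \<gamma>"
    and "muwp_approximation valid w J \<alpha> \<beta> select"
    and "offline_approximation valid w J \<gamma> offline"
    and "preserves_makespan J \<alpha> select offline"
    and "optimal_schedule valid w r J opt"
  shows "(\<integral>\<^sup>+ x. online_cost J w r \<alpha> select offline x \<partial>uniform_measure lborel {0<..1})
    \<le> ennreal ((1 / ln 2 * \<alpha> * \<beta> + \<gamma>) * (\<Sum>j\<in>J. w j * completion_time opt j)
               + \<alpha> * (\<Sum>j\<in>J. w j))"
proof -
  interpret online_run J p valid w r \<alpha> \<beta> \<gamma> select offline opt
    using assms unfolding online_run_def online_run_axioms_def optimal_schedule_def by auto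
  show ?thesis
    using expected_online_cost_le by (simp add: weighted_completion_def)
qed

end
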